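(* For every $a\in\mathbb{C}$, $$F\!\left(2a,a+\tfrac13;\tfrac43;10-6\sqrt3\right)=\frac{3^{-9a/4-5/8}\,(\sqrt3-1)^{-3a-1/2}\sqrt{\pi}\;\Gamma(\tfrac13)}{2^{5/4-3a/2}\,\Gamma(\tfrac{13}{12}-\tfrac12a)\,\Gamma(\tfrac12a+\tfrac34)}.$$
   Context: $F(a,b;c;x)=\sum_{n\ge0}\frac{(a,n)(b,n)}{(c,n)(1,n)}x^n$ with $(\alpha,n)=\Gamma(\alpha+n)/\Gamma(\alpha)$ is the Gauss hypergeometric series. For $t>0$ and $s\in\mathbb{C}$, $t^s=e^{s\log t}$ with real logarithm. $1/\Gamma$ is interpreted as $0$ at the poles of $\Gamma$. *)

theory Defs
  imports "HOL-Analysis.Analysis"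
begin

(* The Gauss series. The symbol (alpha,n) = Gamma(alpha+n) / Gamma(alpha) is the rising factorial
   alpha (alpha+1) ... (alpha+n-1), see pochhammer_Gamma; the product also gives the value
   (by continuity) where alpha is a pole of Gamma. *)
definition hypergeo_F :: "complex \<Rightarrow> complex \<Rightarrow> complex \<Rightarrow> complex \<Rightarrow> complex" where
  "hypergeo_F a b c x =
     (\<Sum>n. pochhammer a n * pochhammer b n / (pochhammer c n * pochhammer 1 n) * x ^ n)"

end

theory Submission
  imports Defs "HOL-Complex_Analysis.Complex_Analysis"
begin

text \<open>
  The local exponents of the hypergeometric equation satisfied by \<open>F(2a, a + 1/3; 4/3; x)\<close> differ by
  \<open>1/3\<close>, \<open>3s\<close> and \<open>s\<close> at \<open>0\<close>, \<open>1\<close> and \<open>\<infinity>\<close>, up to sign, where \<open>s = a - 1/3\<close>. Such an equation is the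
  pull-back of one with exponent differences \<open>1/3\<close>, \<open>1/2\<close>, \<open>s\<close> along the rational function of degree four
  \[ \phi(x) = - \frac{x (x + 8)^3}{64 (1 - x)^3}, \qquad
     1 - \phi(x) = \frac{(x^2 - 20 x - 8)^2}{64 (1 - x)^3}, \]
  whose ramification over \<open>0\<close>, \<open>1\<close>, \<open>\<infinity>\<close> is \<open>1 + 3\<close>, \<open>2 + 2\<close>, \<open>1 + 3\<close>. Comparing exponents
  at \<open>-8\<close>, \<open>1\<close> and \<open>\<infinity>\<close> leads to Goursat's transformation
  \[ F(2a, a + 1/3; 4/3; x) = (1 - x)^{-3/4 - 3a/2} (1 + x/8)
       F(1/4 + a/2, 7/12 - a/2; 4/3; \phi(x)) . \]
  The point \<open>x = 10 - 6 sqrt 3\<close> is the root of \<open>x\<^sup>2 - 20 x - 8\<close> in the unit disc, so there \<open>\<phi>(x) = 1\<close> and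
  Gauss's summation formula evaluates the right-hand side; the remaining factors are powers of
  \<open>2\<close>, \<open>3\<close> and \<open>sqrt 3 - 1\<close>.

  The transformation (\<open>hypergeo_F_quartic_transformation\<close>) is proved by checking that its right-hand
  side satisfies the hypergeometric equation of the left-hand side (\<open>quartic_ode_transfer\<close>), because
  that equation determines a solution holomorphic at \<open>0\<close> from its value there (\<open>hypergeo_F_unique\<close>).
  It holds on the half-open segment from \<open>0\<close> towards \<open>10 - 6 sqrt 3\<close>, where \<open>\<bar>\<phi>\<bar> < 1\<close>. The end point is
  reached by continuity, as the series on the right converges absolutely on the closed unit disc
  (\<open>hypergeo_F_continuous_cball\<close>). Gauss's formula (\<open>Gauss_hypergeo_F_1\<close>) follows from the
  recurrence in \<open>c\<close> for the value at \<open>1\<close> and from the limit of that value as \<open>c\<close> tends to infinity.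
\<close>

section \<open>The hypergeometric equation\<close>

definition hyp_coeff :: "complex \<Rightarrow> complex \<Rightarrow> complex \<Rightarrow> nat \<Rightarrow> complex" where
  "hyp_coeff a b c n = pochhammer a n * pochhammer b n / (pochhammer c n * pochhammer 1 n)"

lemma hyp_coeff_0 [simp]: "hyp_coeff a b c 0 = 1"
  by (simp add: hyp_coeff_def)

lemma plus_of_nat_neq_0:
  fixes c :: complex
  assumes "c \<notin> \<int>\<^sub>\<le>\<^sub>0"
  shows "c + of_nat n \<noteq> 0"
  using assms plus_of_nat_eq_0_imp by blast

lemma hyp_coeff_Suc:
  assumes "c \<notin> \<int>\<^sub>\<le>\<^sub>0"
  shows "of_nat (Suc n) * (c + of_nat n) * hyp_coeff a b c (Suc n) =
           (a + of_nat n) * (b + of_nat n) * hyp_coeff a b c n"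
proof -
  have "c + of_nat n \<noteq> 0" "pochhammer c n \<noteq> 0"
    using assms plus_of_nat_neq_0 pochhammer_eq_0_imp_nonpos_Int by blast+
  moreover have "(1::complex) + of_nat n \<noteq> 0"
    by (metis of_nat_Suc of_nat_neq_0)
  ultimately show ?thesis
    unfolding hyp_coeff_def pochhammer_Suc
    by (simp add: divide_simps pochhammer_fact[symmetric])
qed

lemma hyp_coeff_unique:
  assumes "c \<notin> \<int>\<^sub>\<le>\<^sub>0" "q 0 = 1"
    and "\<And>n. of_nat (Suc n) * (c + of_nat n) * q (Suc n) = (a + of_nat n) * (b + of_nat n) * q n"
  shows "q n = hyp_coeff a b c n"
proof (induction n)
  case (Suc n)
  have "of_nat (Suc n) * (c + of_nat n) * q (Suc n) =
        of_nat (Suc n) * (c + of_nat n) * hyp_coeff a b c (Suc n)"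
    using assms(3)[of n] hyp_coeff_Suc[OF assms(1), of n a b] Suc by simp
  thus ?case
    using plus_of_nat_neq_0[OF assms(1), of n] by (simp del: of_nat_Suc)
qed (use assms in auto)

text \<open>
  Read on coefficients, the hypergeometric equation is a two-term recurrence. This serves in both
  directions: the Gauss series solves the equation, and a power series solution is a Gauss series.
\<close>
lemma fps_hypergeo_ode_iff:
  fixes P :: "complex fps"
  shows "fps_X * (1 - fps_X) * fps_deriv (fps_deriv P) +
           (fps_const c - fps_const (a + b + 1) * fps_X) * fps_deriv P - fps_const (a * b) * P = 0
     \<longleftrightarrow> (\<forall>n. of_nat (Suc n) * (c + of_nat n) * fps_nth P (Suc n) =
               (a + of_nat n) * (b + of_nat n) * fps_nth P n)"
proof -
  have eq: "fps_X * (1 - fps_X) * fps_deriv (fps_deriv P) +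
           (fps_const c - fps_const (a + b + 1) * fps_X) * fps_deriv P - fps_const (a * b) * P =
        fps_X * fps_deriv (fps_deriv P) - fps_X * (fps_X * fps_deriv (fps_deriv P)) +
        fps_const c * fps_deriv P - fps_const (a + b + 1) * (fps_X * fps_deriv P)
          - fps_const (a * b) * P"
    by (simp add: algebra_simps)
  have "fps_nth (fps_X * fps_deriv (fps_deriv P) - fps_X * (fps_X * fps_deriv (fps_deriv P)) +
        fps_const c * fps_deriv P - fps_const (a + b + 1) * (fps_X * fps_deriv P)
          - fps_const (a * b) * P) n =
      of_nat (Suc n) * (c + of_nat n) * fps_nth P (Suc n) -
        (a + of_nat n) * (b + of_nat n) * fps_nth P n" for n
    by (cases n rule: nat.exhaust; cases "n - 1" rule: nat.exhaust) (auto simp: algebra_simps)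
  thus ?thesis
    unfolding eq by (subst fps_eq_iff) simp
qed

text \<open>
  The ratio of consecutive terms tends to the argument, so the ratio test applies at every radius
  below 1. It is applied in the form without division, since the coefficients vanish from some index
  on if \<open>a\<close> or \<open>b\<close> is a nonpositive integer.
\<close>
lemma fps_conv_radius_hypergeo:
  assumes "c \<notin> \<int>\<^sub>\<le>\<^sub>0"
  shows "fps_conv_radius (Abs_fps (hyp_coeff a b c)) \<ge> 1"
  unfolding fps_conv_radius_def
proof (rule conv_radius_geI_ex')
  fix r :: real assume r: "0 < r" "ereal r < 1"
  hence r1: "r < 1" by simp
  define s where "s = (1 + r) / 2"
  have s: "r < s" "s < 1" using r1 by (auto simp: s_def)
  define g where "g = (\<lambda>n. (a / of_nat n + 1) * (b / of_nat n + 1) /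
     ((1 / of_nat n + 1) * (c / of_nat n + 1)) * of_real r :: complex)"
  have "g \<longlonglongrightarrow> (0 + 1) * (0 + 1) / ((0 + 1) * (0 + 1)) * of_real r"
    unfolding g_def by (intro tendsto_intros lim_const_over_n) auto
  hence "(\<lambda>n. norm (g n)) \<longlonglongrightarrow> r"
    using r tendsto_norm by fastforce
  hence "eventually (\<lambda>n. norm (g n) < s) sequentially"
    using s by (intro order_tendstoD)
  hence "eventually (\<lambda>n. norm (hyp_coeff a b c (Suc n) * of_real r ^ Suc n) \<le>
           s * norm (hyp_coeff a b c n * of_real r ^ n)) sequentially"
    using eventually_gt_at_top[of 0]
  proof eventually_elim
    case (elim n)
    have nz: "c + of_nat n \<noteq> 0" "(1::complex) + of_nat n \<noteq> 0" "(of_nat n :: complex) \<noteq> 0"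
      using plus_of_nat_neq_0[OF assms, of n] elim
      by (simp_all) (metis of_nat_Suc of_nat_neq_0)
    have "hyp_coeff a b c (Suc n) =
        (a + of_nat n) * (b + of_nat n) / ((1 + of_nat n) * (c + of_nat n)) * hyp_coeff a b c n"
      using hyp_coeff_Suc[OF assms, of n a b] nz by (simp add: divide_simps) (simp add: algebra_simps)
    also have "\<dots> * of_real r = g n * hyp_coeff a b c n"
      using nz by (simp add: g_def add_divide_eq_iff divide_add_eq_iff)
    finally have "hyp_coeff a b c (Suc n) * of_real r ^ Suc n =
        g n * (hyp_coeff a b c n * of_real r ^ n)"
      by (simp add: mult_ac)
    hence "norm (hyp_coeff a b c (Suc n) * of_real r ^ Suc n) =
        norm (g n) * norm (hyp_coeff a b c n * of_real r ^ n)"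
      by (simp only: norm_mult)
    thus ?case
      using elim by (auto intro: mult_right_mono)
  qed
  then obtain N where "\<And>n. n \<ge> N \<Longrightarrow> norm (hyp_coeff a b c (Suc n) * of_real r ^ Suc n) \<le>
           s * norm (hyp_coeff a b c n * of_real r ^ n)"
    unfolding eventually_sequentially by blast
  hence "summable (\<lambda>n. hyp_coeff a b c n * of_real r ^ n)"
    using s by (intro summable_ratio_test[of s N]) auto
  thus "summable (\<lambda>n. fps_nth (Abs_fps (hyp_coeff a b c)) n * of_real r ^ n)"
    by simp
qed

lemma hypergeo_F_eval_fps: "hypergeo_F a b c = eval_fps (Abs_fps (hyp_coeff a b c))"
  by (simp add: fun_eq_iff hypergeo_F_def eval_fps_def hyp_coeff_def)

lemma hypergeo_F_0 [simp]: "hypergeo_F a b c 0 = 1"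
  by (simp add: hypergeo_F_eval_fps eval_fps_at_0)

lemma norm_less_conv_radius:
  assumes "norm z < 1" "1 \<le> R"
  shows "ereal (norm z) < R"
  using assms by (metis ereal_less(3) less_le_trans)

lemma hypergeo_F_holomorphic:
  assumes "c \<notin> \<int>\<^sub>\<le>\<^sub>0"
  shows "hypergeo_F a b c holomorphic_on ball 0 1"
  unfolding hypergeo_F_eval_fps using fps_conv_radius_hypergeo[OF assms]
  by (intro holomorphic_on_eval_fps) (simp add: subset_iff norm_less_conv_radius)

lemma hypergeo_F_ode:
  assumes c: "c \<notin> \<int>\<^sub>\<le>\<^sub>0"
  obtains H1 H2 where
    "\<And>z. norm z < 1 \<Longrightarrow> (hypergeo_F a b c has_field_derivative H1 z) (at z)"
    "\<And>z. norm z < 1 \<Longrightarrow> (H1 has_field_derivative H2 z) (at z)"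
    "\<And>z. norm z < 1 \<Longrightarrow>
       z * (1 - z) * H2 z + (c - (a + b + 1) * z) * H1 z - a * b * hypergeo_F a b c z = 0"
proof -
  define P where "P = Abs_fps (hyp_coeff a b c)"
  have rad0: "fps_conv_radius P \<ge> 1"
    unfolding P_def by (rule fps_conv_radius_hypergeo[OF c])
  have rad1: "fps_conv_radius (fps_deriv P) \<ge> 1"
    using rad0 fps_conv_radius_deriv by (rule order_trans)
  have rad2: "fps_conv_radius (fps_deriv (fps_deriv P)) \<ge> 1"
    using rad1 fps_conv_radius_deriv by (rule order_trans)
  note rad = rad0 rad1 rad2
  define H1 H2 where "H1 = eval_fps (fps_deriv P)" and "H2 = eval_fps (fps_deriv (fps_deriv P))"
  have F: "hypergeo_F a b c = eval_fps P"
    by (simp add: hypergeo_F_eval_fps P_def)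
  have pos: "fps_conv_radius P > 0" "fps_conv_radius (fps_deriv P) > 0"
      "fps_conv_radius (fps_deriv (fps_deriv P)) > 0"
    using rad norm_less_conv_radius[of "0::complex"] by (simp_all add: zero_ereal_def)
  have D1: "(hypergeo_F a b c has_field_derivative H1 z) (at z)" if "norm z < 1" for z
    unfolding F H1_def using that rad by (intro has_field_derivative_eval_fps norm_less_conv_radius)
  have D2: "(H1 has_field_derivative H2 z) (at z)" if "norm z < 1" for z
    unfolding H1_def H2_def using that rad by (intro has_field_derivative_eval_fps norm_less_conv_radius)
  define D where "D = (\<lambda>z. z * (1 - z) * H2 z + (c - (a + b + 1) * z) * H1 z - 
                           a * b * hypergeo_F a b c z)"
  have "D has_fps_expansion fps_X * (1 - fps_X) * fps_deriv (fps_deriv P) +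
           (fps_const c - fps_const (a + b + 1) * fps_X) * fps_deriv P - fps_const (a * b) * P"
    unfolding D_def F H1_def H2_def
    by (intro fps_expansion_intros eval_fps_has_fps_expansion pos)
  also have "\<dots> = 0"
    using hyp_coeff_Suc[OF c] by (subst fps_hypergeo_ode_iff) (auto simp: P_def)
  finally have "D has_fps_expansion 0" .
  moreover have "D holomorphic_on ball 0 1"
    unfolding D_def F H1_def H2_def using rad
    by (intro holomorphic_intros holomorphic_on_eval_fps)
       (simp_all add: subset_iff norm_less_conv_radius)
  ultimately have "D z = 0" if "norm z < 1" for z
    using that by (intro has_fps_expansion_0_analytic_continuation[of D "ball 0 1"]) auto
  with D1 D2 show thesis
    unfolding D_def by (intro that) auto
qed

text \<open>
  At the singular point \<open>0\<close> the equation has exponents \<open>0\<close> and \<open>1 - c\<close>. Since \<open>c\<close> is not a nonpositive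
  integer, the recurrence for the Taylor coefficients never degenerates, so the value at \<open>0\<close> fixes the
  Taylor series; the identity theorem carries the equality through the connected set \<open>S\<close>.
\<close>
lemma hypergeo_F_unique:
  assumes c: "c \<notin> \<int>\<^sub>\<le>\<^sub>0"
    and S: "open S" "connected S" "0 \<in> S" "S \<subseteq> ball 0 1"
    and f1: "\<And>z. z \<in> S \<Longrightarrow> (f has_field_derivative f1 z) (at z)"
    and f2: "\<And>z. z \<in> S \<Longrightarrow> (f1 has_field_derivative f2 z) (at z)"
    and ode: "\<And>z. z \<in> S \<Longrightarrow>
       z * (1 - z) * f2 z + (c - (a + b + 1) * z) * f1 z - a * b * f z = 0"
    and f0: "f 0 = 1"
    and z: "z \<in> S"
  shows "f z = hypergeo_F a b c z"
proof -
  have ev_S: "eventually (\<lambda>z. z \<in> S) (nhds 0)"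
    using S by (intro eventually_nhds_in_open)
  have f_hol: "f holomorphic_on S"
    using f1 \<open>open S\<close> by (subst holomorphic_on_open) auto
  hence "f analytic_on {0}"
    using S analytic_at by blast
  then obtain P where P: "f has_fps_expansion P"
    using analytic_at_imp_has_fps_expansion_0 by blast
  have "eventually (\<lambda>z. deriv f z = f1 z) (nhds 0)"
    using ev_S by eventually_elim (auto intro: DERIV_imp_deriv f1)
  hence P1: "f1 has_fps_expansion fps_deriv P"
    using has_fps_expansion_deriv[OF P] has_fps_expansion_cong by blast
  have "eventually (\<lambda>z. deriv f1 z = f2 z) (nhds 0)"
    using ev_S by eventually_elim (auto intro: DERIV_imp_deriv f2)
  hence P2: "f2 has_fps_expansion fps_deriv (fps_deriv P)"
    using has_fps_expansion_deriv[OF P1] has_fps_expansion_cong by blast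
  have "(\<lambda>z. z * (1 - z) * f2 z + (c - (a + b + 1) * z) * f1 z - a * b * f z) has_fps_expansion 
          fps_X * (1 - fps_X) * fps_deriv (fps_deriv P) +
           (fps_const c - fps_const (a + b + 1) * fps_X) * fps_deriv P - fps_const (a * b) * P"
    by (intro fps_expansion_intros P P1 P2)
  moreover have "(\<lambda>z. z * (1 - z) * f2 z + (c - (a + b + 1) * z) * f1 z - a * b * f z)
                    has_fps_expansion 0"
    using eventually_mono[OF ev_S ode] by (simp add: has_fps_expansion_0_iff)
  ultimately have "fps_X * (1 - fps_X) * fps_deriv (fps_deriv P) +
           (fps_const c - fps_const (a + b + 1) * fps_X) * fps_deriv P - fps_const (a * b) * P = 0"
    by (rule fps_expansion_unique_complex)
  hence rec: "\<And>n. of_nat (Suc n) * (c + of_nat n) * fps_nth P (Suc n) =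
               (a + of_nat n) * (b + of_nat n) * fps_nth P n"
    by (subst (asm) fps_hypergeo_ode_iff) blast
  have "fps_nth P 0 = 1"
    using has_fps_expansion_imp_0_eq_fps_nth_0[OF P] f0 by simp
  hence "fps_nth P n = hyp_coeff a b c n" for n
    using rec by (intro hyp_coeff_unique[OF c]) 
  hence "P = Abs_fps (hyp_coeff a b c)"
    by (simp add: fps_eq_iff)
  moreover have "hypergeo_F a b c has_fps_expansion Abs_fps (hyp_coeff a b c)"
    unfolding hypergeo_F_eval_fps
    using less_le_trans[OF _ fps_conv_radius_hypergeo[OF c, of a b], of 0]
    by (intro eval_fps_has_fps_expansion) auto
  ultimately have "(\<lambda>z. f z - hypergeo_F a b c z) has_fps_expansion 0"
    using has_fps_expansion_diff[OF P] by fastforce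
  moreover have "(\<lambda>z. f z - hypergeo_F a b c z) holomorphic_on S"
    using f_hol hypergeo_F_holomorphic[OF c, of a b] S
    by (auto intro!: holomorphic_intros intro: holomorphic_on_subset)
  ultimately have "f z - hypergeo_F a b c z = 0"
    using S z by (intro has_fps_expansion_0_analytic_continuation[of _ S z])
  thus ?thesis by simp
qed

section \<open>Behaviour on the unit circle\<close>

lemma notin_nonpos_Ints_if_Re_pos: "Re z > 0 \<Longrightarrow> z \<notin> \<int>\<^sub>\<le>\<^sub>0"
  by (auto elim!: nonpos_Ints_cases)

lemma plus_of_nat_notin_nonpos_Ints:
  fixes c :: complex
  assumes "c \<notin> \<int>\<^sub>\<le>\<^sub>0"
  shows "c + of_nat m \<notin> \<int>\<^sub>\<le>\<^sub>0"
proof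
  assume "c + of_nat m \<in> \<int>\<^sub>\<le>\<^sub>0"
  then obtain k where "c + of_nat m = - of_nat k"
    by (elim nonpos_Ints_cases')
  hence "c + of_nat (m + k) = 0" by (simp add: add.assoc[symmetric])
  thus False using plus_of_nat_neq_0[OF assms] by blast
qed

text \<open>
  Euler's limit formula for \<open>1 / \<Gamma>\<close> gives the exact order of a rising factorial; in the quotient that
  defines the coefficient the factorials cancel up to one factor \<open>n + 1\<close>, and the powers of \<open>n\<close> combine to
  the exponent \<open>a + b - c\<close>.
\<close>
lemma hyp_coeff_growth:
  assumes c: "c \<notin> \<int>\<^sub>\<le>\<^sub>0"
  obtains K where "K > 0"
    "\<And>n. n > 0 \<Longrightarrow> norm (of_nat (Suc n) * hyp_coeff a b c (Suc n)) \<le> K * real n powr - Re (c - a - b)"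
proof -
  define q where "q = (\<lambda>n. rGamma_series a n * rGamma_series b n / rGamma_series c n)"
  have "q \<longlonglongrightarrow> rGamma a * rGamma b / rGamma c"
    unfolding q_def using c by (intro tendsto_intros) (simp add: rGamma_eq_zero_iff)
  hence "Bseq q"
    using convergentI Bseq_conv_Bfun convergent_imp_Bseq by blast
  then obtain K where K: "K > 0" "\<And>n. norm (q n) \<le> K"
    by (elim BseqE) auto
  have "norm (of_nat (Suc n) * hyp_coeff a b c (Suc n)) \<le> K * real n powr - Re (c - a - b)"
    if n: "n > 0" for n
  proof -
    have nz: "pochhammer c (Suc n) \<noteq> 0"
      using c pochhammer_eq_0_imp_nonpos_Int by blast
    define L :: complex where "L = of_real (ln (real n))"
    have "exp (-(c - a - b) * L) * q n = exp (- (c * L)) * exp (a * L) * exp (b * L) * q n"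
      by (simp add: algebra_simps flip: exp_add)
    also have "\<dots> = pochhammer a (Suc n) * pochhammer b (Suc n) / (pochhammer c (Suc n) * fact n)"
      using nz unfolding q_def rGamma_series_def L_def[symmetric] 
      by (simp add: exp_minus divide_simps)
    also have "\<dots> = of_nat (Suc n) * hyp_coeff a b c (Suc n)"
      unfolding hyp_coeff_def pochhammer_fact[symmetric] fact_Suc
      by (simp add: divide_simps del: of_nat_Suc)
    finally have "norm (of_nat (Suc n) * hyp_coeff a b c (Suc n)) =
        norm (exp (-(c - a - b) * L)) * norm (q n)"
      by (metis norm_mult)
    also have "norm (exp (-(c - a - b) * L)) = real n powr - Re (c - a - b)"
      using n by (simp add: L_def powr_def)
    also have "real n powr - Re (c - a - b) * norm (q n) \<le> real n powr - Re (c - a - b) * K"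
      by (intro mult_left_mono K) auto
    also have "\<dots> = K * real n powr - Re (c - a - b)"
      by (rule mult.commute)
    finally show ?thesis .
  qed
  with K(1) show thesis by (rule that)
qed

lemma hyp_coeff_abs_summable:
  assumes c: "c \<notin> \<int>\<^sub>\<le>\<^sub>0" and s: "Re (c - a - b) > 0"
  shows "summable (\<lambda>n. norm (hyp_coeff a b c n))"
proof -
  obtain K where K: "K > 0" "\<And>n. n > 0 \<Longrightarrow>
      norm (of_nat (Suc n) * hyp_coeff a b c (Suc n)) \<le> K * real n powr - Re (c - a - b)"
    using hyp_coeff_growth[OF c, of a b] by blast
  have major: "summable (\<lambda>n. K * real n powr (- Re (c - a - b) - 1))"
    using s by (intro summable_mult) (simp add: summable_real_powr_iff)
  have "norm (hyp_coeff a b c (Suc n)) \<le> K * real n powr (- Re (c - a - b) - 1)"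
    if n: "n \<ge> 1" for n
  proof -
    have "real n * norm (hyp_coeff a b c (Suc n)) \<le> real (Suc n) * norm (hyp_coeff a b c (Suc n))"
      by (intro mult_right_mono) auto
    also have "\<dots> \<le> K * real n powr - Re (c - a - b)"
      using K(2)[of n] n by (simp add: norm_mult del: of_nat_Suc)
    finally have "norm (hyp_coeff a b c (Suc n)) \<le> K * real n powr - Re (c - a - b) / real n"
      using n by (subst pos_le_divide_eq) (auto simp only: of_nat_0_less_iff mult.commute)
    thus ?thesis
      using n by (simp add: powr_diff)
  qed
  hence "summable (\<lambda>n. norm (hyp_coeff a b c (Suc n)))"
    by (intro summable_comparison_test'[OF major, of 1]) (simp only: real_norm_def abs_norm_cancel)
  thus ?thesis by (subst (asm) summable_Suc_iff)
qed

lemma hyp_coeff_times_index_tendsto_0: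
  assumes c: "c \<notin> \<int>\<^sub>\<le>\<^sub>0" and s: "Re (c - a - b) > 0"
  shows "(\<lambda>n. of_nat n * hyp_coeff a b c n) \<longlonglongrightarrow> 0"
proof -
  obtain K where K: "K > 0" "\<And>n. n > 0 \<Longrightarrow>
      norm (of_nat (Suc n) * hyp_coeff a b c (Suc n)) \<le> K * real n powr - Re (c - a - b)"
    using hyp_coeff_growth[OF c, of a b] by blast
  have "(\<lambda>n. K * real n powr - Re (c - a - b)) \<longlonglongrightarrow> K * 0"
    using s by (intro tendsto_mult tendsto_const tendsto_neg_powr filterlim_real_sequentially) auto
  hence "(\<lambda>n. of_nat (Suc n) * hyp_coeff a b c (Suc n)) \<longlonglongrightarrow> 0"
    by (intro Lim_null_comparison[OF eventually_mono[OF eventually_gt_at_top[of 0] K(2)]]) auto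
  thus ?thesis by (subst (asm) filterlim_sequentially_Suc)
qed

text \<open>
  A substitute for Abel's limit theorem: the coefficients are absolutely summable, so the convergence
  is uniform on the closed disc.
\<close>
lemma hypergeo_F_continuous_cball:
  assumes c: "c \<notin> \<int>\<^sub>\<le>\<^sub>0" and s: "Re (c - a - b) > 0"
  shows "continuous_on (cball 0 1) (hypergeo_F a b c)"
proof -
  have "uniform_limit (cball 0 1) (\<lambda>n z. \<Sum>k<n. hyp_coeff a b c k * z ^ k)
          (\<lambda>z. \<Sum>k. hyp_coeff a b c k * z ^ k) sequentially"
    using hyp_coeff_abs_summable[OF c s]
    by (intro Weierstrass_m_test)
       (auto simp: norm_mult norm_power power_le_one mult_left_le)
  hence "continuous_on (cball 0 1) (\<lambda>z. \<Sum>k. hyp_coeff a b c k * z ^ k)"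
    by (rule uniform_limit_theorem[rotated]) (auto intro!: always_eventually continuous_intros)
  thus ?thesis
    by (simp add: hypergeo_F_def[abs_def] hyp_coeff_def)
qed

section \<open>Gauss's summation formula\<close>

lemma hypergeo_F_1: "hypergeo_F a b c 1 = (\<Sum>n. hyp_coeff a b c n)"
  by (simp add: hypergeo_F_def hyp_coeff_def)

text \<open>
  If \<open>t(n)\<close> and \<open>t'(n)\<close> are the coefficients for \<open>c\<close> and \<open>c + 1\<close>, the combination
  \<open>c (c - a - b) t(n) - (c - a) (c - b) t'(n)\<close> is \<open>- c\<close> times the increment of \<open>n t(n)\<close>. So its sum
  telescopes, and the boundary term tends to \<open>0\<close> by the growth estimate.
\<close>
lemma hypergeo_F_contiguous_1:
  assumes c: "c \<notin> \<int>\<^sub>\<le>\<^sub>0" and s: "Re (c - a - b) > 0"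
  shows "c * (c - a - b) * hypergeo_F a b c 1 = (c - a) * (c - b) * hypergeo_F a b (c + 1) 1"
proof -
  define t where "t = hyp_coeff a b c"
  define t' where "t' = hyp_coeff a b (c + 1)"
  have c1: "c + 1 \<notin> \<int>\<^sub>\<le>\<^sub>0"
    using plus_of_nat_notin_nonpos_Ints[OF c, of 1] by simp
  have c0: "c + of_nat n \<noteq> 0" for n
    using c by (rule plus_of_nat_neq_0)
  have t': "t' n = c / (c + of_nat n) * t n" for n
  proof -
    have "pochhammer c n * (c + of_nat n) = c * pochhammer (c + 1) n"
      by (metis pochhammer_Suc pochhammer_rec)
    hence "pochhammer (c + 1) n = pochhammer c n * (c + of_nat n) / c"
      using c0[of 0] by (simp add: field_simps)
    thus ?thesis
      by (simp add: t_def t'_def hyp_coeff_def mult_ac)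
  qed
  have telescope: "c * (c - a - b) * t n - (c - a) * (c - b) * t' n =
      - c * (of_nat (Suc n) * t (Suc n) - of_nat n * t n)" for n
  proof -
    define w where "w = inverse (c + of_nat n)"
    have w: "w * (c + of_nat n) = 1"
      using c0[of n] by (simp add: w_def)
    have t'_n: "t' n = c * w * t n"
      by (simp add: t' w_def divide_inverse)
    have "of_nat (Suc n) * t (Suc n) = w * (of_nat (Suc n) * (c + of_nat n) * t (Suc n))"
      using w by (metis mult.assoc mult.commute mult_1_right)
    also have "of_nat (Suc n) * (c + of_nat n) * t (Suc n) =
        (a + of_nat n) * (b + of_nat n) * t n"
      unfolding t_def by (rule hyp_coeff_Suc[OF c])
    finally have t_Suc: "of_nat (Suc n) * t (Suc n) = w * ((a + of_nat n) * (b + of_nat n) * t n)" .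
    \<comment> \<open>The last factor on the right isolates the only relation between \<open>w\<close>, \<open>c\<close> and \<open>n\<close> that is needed.\<close>
    have "c * (c - a - b) * t n - (c - a) * (c - b) * t' n +
        c * (of_nat (Suc n) * t (Suc n) - of_nat n * t n) =
        c * t n * (c - a - b - of_nat n) * (1 - w * (c + of_nat n))"
      unfolding t'_n t_Suc by (simp add: algebra_simps)
    also have "\<dots> = 0"
      using w by simp
    finally show ?thesis
      by (simp add: eq_neg_iff_add_eq_0 del: of_nat_Suc)
  qed
  have "(\<lambda>n. of_nat n * t n) \<longlonglongrightarrow> 0"
    unfolding t_def using c s by (rule hyp_coeff_times_index_tendsto_0)
  from telescope_sums[OF this]
  have "(\<lambda>n. of_nat (Suc n) * t (Suc n) - of_nat n * t n) sums 0"
    by simp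
  from sums_mult[OF this, of "-c"]
  have "(\<lambda>n. c * (c - a - b) * t n - (c - a) * (c - b) * t' n) sums 0"
    unfolding telescope by simp
  moreover have "t sums hypergeo_F a b c 1"
    unfolding hypergeo_F_1 t_def
    by (rule summable_sums[OF summable_norm_cancel[OF hyp_coeff_abs_summable[OF c s]]])
  moreover have "t' sums hypergeo_F a b (c + 1) 1"
    unfolding hypergeo_F_1 t'_def using s
    by (intro summable_sums[OF summable_norm_cancel[OF hyp_coeff_abs_summable[OF c1]]]) auto
  ultimately have "c * (c - a - b) * hypergeo_F a b c 1 -
      (c - a) * (c - b) * hypergeo_F a b (c + 1) 1 = 0"
    using sums_unique2[OF sums_diff[OF sums_mult sums_mult]] by blast
  thus ?thesis by simp
qed

lemma norm_pochhammer_le: "norm (pochhammer z n) \<le> pochhammer (norm z) n"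
  for z :: complex
proof (induction n)
  case (Suc n)
  have "norm (z + of_nat n) \<le> norm z + real n"
    by (metis norm_triangle_ineq norm_of_nat)
  thus ?case
    using Suc order_trans[OF norm_ge_zero Suc] unfolding pochhammer_Suc norm_mult
    by (intro mult_mono) auto
qed auto

lemma pochhammer_le_norm_pochhammer:
  fixes z :: complex
  assumes "0 \<le> r" "r \<le> Re z"
  shows "pochhammer r n \<le> norm (pochhammer z n)"
proof (induction n)
  case (Suc n)
  have "r + real n \<le> norm (z + of_nat n)"
    using complex_Re_le_cmod[of "z + of_nat n"] assms by simp
  thus ?case
    using Suc assms by (simp add: pochhammer_Suc norm_mult mult_mono pochhammer_nonneg)
qed auto

lemma pochhammer_norm_nonneg: "0 \<le> pochhammer (norm z) n" for z :: complex
  using norm_ge_zero norm_pochhammer_le by (rule order_trans)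

text \<open>
  A majorant with real parameters that does not depend on \<open>c\<close> as long as \<open>Re c\<close> stays above \<open>r\<close>: this
  provides the uniformity needed for letting \<open>c\<close> tend to infinity.
\<close>
lemma norm_hyp_coeff_le:
  assumes "0 < r" "r \<le> Re c"
  shows "norm (hyp_coeff a b c n) \<le> norm (hyp_coeff (norm a) (norm b) r n)"
proof -
  have "norm (hyp_coeff a b c n) \<le>
          pochhammer (norm a) n * pochhammer (norm b) n / (pochhammer r n * fact n)"
    unfolding hyp_coeff_def norm_divide norm_mult pochhammer_fact[symmetric]
    using assms
    by (intro frac_le mult_mono norm_pochhammer_le pochhammer_le_norm_pochhammer)
       (auto simp: pochhammer_pos pochhammer_norm_nonneg)
  also have "\<dots> = norm (hyp_coeff (norm a) (norm b) r n)"
    unfolding hyp_coeff_def norm_divide norm_mult pochhammer_fact[symmetric]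
      pochhammer_of_real norm_of_real
    using assms by (simp add: pochhammer_pos pochhammer_norm_nonneg abs_of_nonneg less_imp_le)
  finally show ?thesis .
qed

text \<open>
  All coefficients except the first contain the factor \<open>1 / c\<close>. Splitting it off leaves the
  coefficients with all three parameters raised by one, whose sum is bounded uniformly for large \<open>m\<close>.
\<close>
lemma hypergeo_F_1_tendsto_1:
  assumes c: "c \<notin> \<int>\<^sub>\<le>\<^sub>0"
  shows "(\<lambda>m. hypergeo_F a b (c + of_nat m) 1) \<longlonglongrightarrow> 1"
proof -
  \<comment> \<open>The summand 1 makes the majorising series with parameters \<open>norm (a + 1)\<close>, \<open>norm (b + 1)\<close>, \<open>r\<close> converge at 1.\<close>
  define r where "r = norm (a + 1) + norm (b + 1) + 1"
  define K where "K = (\<Sum>n. norm (hyp_coeff (norm (a + 1)) (norm (b + 1)) r n))"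
  have r: "r > 0"
    unfolding r_def using norm_ge_zero[of "a + 1"] norm_ge_zero[of "b + 1"] by linarith
  have sum: "summable (\<lambda>n. norm (hyp_coeff (norm (a + 1)) (norm (b + 1)) r n))"
    using r by (intro hyp_coeff_abs_summable notin_nonpos_Ints_if_Re_pos) (auto simp: r_def)
  have bound: "norm (hypergeo_F a b (c + of_nat m) 1 - 1) \<le> norm (a * b) / norm (c + of_nat m) * K"
    if m: "real m \<ge> r - Re c" for m
  proof -
    define C where "C = c + of_nat m"
    have C: "C \<notin> \<int>\<^sub>\<le>\<^sub>0" "r \<le> Re C"
      using m r by (auto simp: C_def intro!: notin_nonpos_Ints_if_Re_pos)
    have Suc: "hyp_coeff a b C (Suc n) = a * b / (C * (1 + of_nat n)) * hyp_coeff (a + 1) (b + 1) (C + 1) n"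
      for n
      unfolding hyp_coeff_def pochhammer_fact[symmetric] by (simp add: pochhammer_rec mult_ac)
    have le: "norm (hyp_coeff a b C (Suc n)) \<le>
       norm (a * b) / norm C * norm (hyp_coeff (norm (a + 1)) (norm (b + 1)) r n)" for n
    proof -
      have C0: "C \<noteq> 0" using C r by auto
      have "norm (a * b / (C * (1 + of_nat n))) = norm (a * b) / norm C / real (Suc n)"
        by (simp add: norm_divide norm_mult flip: of_nat_Suc)
      also have "\<dots> \<le> norm (a * b) / norm C"
        using frac_le[of "norm (a * b) / norm C" "norm (a * b) / norm C" 1 "real (Suc n)"] by simp
      finally show ?thesis
        unfolding Suc norm_mult[of "a * b / (C * (1 + of_nat n))"]
        using C r by (intro mult_mono norm_hyp_coeff_le) auto
    qed
    have summ: "summable (\<lambda>n. norm (a * b) / norm C * norm (hyp_coeff (norm (a + 1)) (norm (b + 1)) r n))"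
      by (intro summable_mult sum)
    have summ': "summable (\<lambda>n. norm (hyp_coeff a b C (Suc n)))"
      by (rule summable_comparison_test'[OF summ, of 0]) (use le in auto)
    hence "summable (\<lambda>n. hyp_coeff a b C (Suc n))"
      by (rule summable_norm_cancel)
    hence "summable (hyp_coeff a b C)"
      by (subst (asm) summable_Suc_iff)
    hence "hypergeo_F a b C 1 - 1 = (\<Sum>n. hyp_coeff a b C (Suc n))"
      unfolding hypergeo_F_1 by (subst suminf_split_head) auto
    also have "norm \<dots> \<le> (\<Sum>n. norm (hyp_coeff a b C (Suc n)))"
      by (rule summable_norm[OF summ'])
    also have "\<dots> \<le> (\<Sum>n. norm (a * b) / norm C * norm (hyp_coeff (norm (a + 1)) (norm (b + 1)) r n))"
      by (rule suminf_le[OF le summ' summ])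
    also have "\<dots> = norm (a * b) / norm C * K"
      unfolding K_def by (rule suminf_mult[OF sum])
    finally show ?thesis by (simp add: C_def)
  qed
  have "filterlim (\<lambda>m. c + of_nat m) at_infinity sequentially"
    by (intro tendsto_add_filterlim_at_infinity[OF tendsto_const] tendsto_of_nat)
  hence "filterlim (\<lambda>m. norm (c + of_nat m)) at_top sequentially"
    by (rule filterlim_at_infinity_imp_norm_at_top)
  hence "(\<lambda>m. norm (a * b) / norm (c + of_nat m) * K) \<longlonglongrightarrow> 0"
    by (intro tendsto_mult_left_zero real_tendsto_divide_at_top[OF tendsto_const])
  moreover have "eventually (\<lambda>m. real m \<ge> r - Re c) sequentially"
    by (metis eventually_sequentiallyI nat_ceiling_le_eq)
  hence "eventually (\<lambda>m. norm (hypergeo_F a b (c + of_nat m) 1 - 1) \<le>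
           norm (a * b) / norm (c + of_nat m) * K) sequentially"
    by (rule eventually_mono) (rule bound)
  ultimately have "(\<lambda>m. hypergeo_F a b (c + of_nat m) 1 - 1) \<longlonglongrightarrow> 0"
    by (rule Lim_null_comparison[rotated])
  thus ?thesis by (simp add: LIM_zero_iff)
qed

text \<open>
  Iterating the recurrence in \<open>c\<close> expresses the value as a quotient of rising factorials times the
  value at \<open>c + m\<close>. In that quotient the factors \<open>m! m\<^sup>z\<close> of Euler's limit formula for \<open>1 / \<Gamma>\<close> cancel, since
  \<open>(c - a) + (c - b) = c + (c - a - b)\<close>, and the four limits give the four Gamma values.
\<close>
theorem Gauss_hypergeo_F_1:
  assumes c: "c \<notin> \<int>\<^sub>\<le>\<^sub>0" and s: "Re (c - a - b) > 0"
  shows "hypergeo_F a b c 1 = Gamma c * Gamma (c - a - b) * rGamma (c - a) * rGamma (c - b)"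
proof -
  have d: "c - a - b \<notin> \<int>\<^sub>\<le>\<^sub>0"
    using s by (rule notin_nonpos_Ints_if_Re_pos)
  have iterate: "pochhammer c m * pochhammer (c - a - b) m * hypergeo_F a b c 1 =
      pochhammer (c - a) m * pochhammer (c - b) m * hypergeo_F a b (c + of_nat m) 1" for m
  proof (induction m)
    case (Suc m)
    have "(c + of_nat m) * (c + of_nat m - a - b) * hypergeo_F a b (c + of_nat m) 1 =
        (c + of_nat m - a) * (c + of_nat m - b) * hypergeo_F a b (c + of_nat m + 1) 1"
      using s by (intro hypergeo_F_contiguous_1 plus_of_nat_notin_nonpos_Ints c) auto
    thus ?case
      using Suc by (simp add: pochhammer_Suc add_ac) algebra
  qed auto
  define R where "R = (\<lambda>m. rGamma_series (c - a) m * rGamma_series (c - b) m /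
                            (rGamma_series c m * rGamma_series (c - a - b) m))"
  have eq: "hypergeo_F a b c 1 = R m * hypergeo_F a b (c + of_nat (Suc m)) 1" for m
  proof -
    define L :: complex where "L = of_real (ln (real m))"
    have nz: "pochhammer c (Suc m) \<noteq> 0" "pochhammer (c - a - b) (Suc m) \<noteq> 0"
      using c d pochhammer_eq_0_imp_nonpos_Int by blast+
    have "exp ((c - a) * L) * exp ((c - b) * L) = exp (c * L) * exp ((c - a - b) * L)"
      by (simp add: algebra_simps flip: exp_add)
    hence "R m = pochhammer (c - a) (Suc m) * pochhammer (c - b) (Suc m) /
        (pochhammer c (Suc m) * pochhammer (c - a - b) (Suc m))"
      using nz unfolding R_def rGamma_series_def L_def[symmetric]
      by (simp add: divide_simps) 
    moreover have "pochhammer c (Suc m) * pochhammer (c - a - b) (Suc m) \<noteq> 0"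
      using nz by simp
    ultimately show ?thesis
      using iterate[of "Suc m"] by (metis nonzero_mult_div_cancel_left times_divide_eq_left)
  qed
  have "(\<lambda>m. hypergeo_F a b (c + of_nat (Suc m)) 1) \<longlonglongrightarrow> 1"
    using hypergeo_F_1_tendsto_1[OF c] by (rule filterlim_compose[OF _ filterlim_Suc])
  hence "(\<lambda>m. R m * hypergeo_F a b (c + of_nat (Suc m)) 1) \<longlonglongrightarrow>
      rGamma (c - a) * rGamma (c - b) / (rGamma c * rGamma (c - a - b)) * 1"
    unfolding R_def using c d by (intro tendsto_intros) (auto simp: rGamma_eq_zero_iff)
  hence "(\<lambda>m. hypergeo_F a b c 1) \<longlonglongrightarrow>
      rGamma (c - a) * rGamma (c - b) / (rGamma c * rGamma (c - a - b))"
    by (simp only: eq[symmetric] mult_1_right)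
  thus ?thesis
    by (simp add: LIMSEQ_const_iff Gamma_def field_simps)
qed


section \<open>The transformation of degree four\<close>

text \<open>
  The covering \<open>\<phi>\<close> of degree four described at the beginning.
\<close>
definition quartic :: "complex \<Rightarrow> complex" where
  "quartic x = - x * (x + 8) ^ 3 / (64 * (1 - x) ^ 3)"

lemma one_minus_quartic:
  assumes "x \<noteq> 1"
  shows "1 - quartic x = (x\<^sup>2 - 20 * x - 8)\<^sup>2 / (64 * (1 - x) ^ 3)"
proof -
  have "64 * (1 - x) ^ 3 \<noteq> 0" using assms by simp
  moreover have "64 * (1 - x) ^ 3 + x * (x + 8) ^ 3 = (x\<^sup>2 - 20 * x - 8)\<^sup>2"
    by algebra
  ultimately show ?thesis
    by (simp add: quartic_def field_simps)
qed

text \<open>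
  Here \<open>u = 1 / (1 - x)\<close>, and \<open>z\<close>, \<open>d\<close>, \<open>d'\<close> stand for \<open>\<phi>\<close>, \<open>\<phi>'\<close>, \<open>\<phi>''\<close> at \<open>x\<close>; \<open>H0\<close>, \<open>H1\<close>, \<open>H2\<close> are the
  derivatives of order 0, 1, 2 at \<open>z\<close> of the series on the right of the transformation, and \<open>G0\<close>, \<open>G1\<close>,
  \<open>G2\<close> those of the whole right-hand side at \<open>x\<close>, divided by the common factor \<open>(1 - x) powr - e\<close>.

  The left-hand side of the equation in \<open>x\<close> is \<open>k = - (x + 8)\<^sup>2 u / 8\<close> times the left-hand side of the
  equation in \<open>z\<close>. For the second-order terms this is \<open>x (1 - x) \<phi>'\<^sup>2 = - (x + 8) u \<phi> (1 - \<phi>)\<close>, a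
  consequence of the factorisations of \<open>\<phi>\<close> and \<open>1 - \<phi>\<close>. The coefficients of \<open>H0\<close>, \<open>H1\<close> and \<open>H2\<close> are
  compared separately, after the negative powers of \<open>w = 1 - x\<close> are cleared by \<open>w u = 1\<close>; what is
  left are polynomial identities in \<open>x\<close> and \<open>a\<close>.
\<close>
lemma quartic_ode_transfer:
  fixes a x u z d d' e H0 H1 H2 :: complex
  assumes u: "(1 - x) * u = 1"
    and z: "z = - x * (x + 8) ^ 3 * u ^ 3 / 64"
    and d: "d = (x + 8)\<^sup>2 * (x\<^sup>2 - 20 * x - 8) * u ^ 4 / 64"
    and d': "d' = (x + 8) * u ^ 4 * (2 * (x\<^sup>2 - 20 * x - 8) + (x + 8) * (2 * x - 20)
                    + 4 * (x + 8) * (x\<^sup>2 - 20 * x - 8) * u) / 64"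
    and e: "e = 3/4 + 3 * a / 2"
    and ode: "z * (1 - z) * H2 +
       (4/3 - ((1/4 + a/2) + (7/12 - a/2) + 1) * z) * H1 - (1/4 + a/2) * (7/12 - a/2) * H0 = 0"
    and G0: "G0 = (1 + x / 8) * H0"
    and G1: "G1 = (1/8 + e * u * (1 + x / 8)) * H0 + (1 + x / 8) * d * H1"
    and G2: "G2 = (e * u / 4 + e * (e + 1) * u\<^sup>2 * (1 + x / 8)) * H0
                  + ((1/4 + 2 * e * u * (1 + x / 8)) * d + (1 + x / 8) * d') * H1
                  + (1 + x / 8) * d\<^sup>2 * H2"
  shows "x * (1 - x) * G2 + (4/3 - (2 * a + (a + 1/3) + 1) * x) * G1 - 2 * a * (a + 1/3) * G0 = 0"
proof -
  define w where "w = 1 - x"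
  define s where "s = x + 8"
  define q where "q = x\<^sup>2 - 20 * x - 8"
  have wu: "w * u = 1" using u by (simp add: w_def)
  have eight: "1 + x / 8 = s / 8" by (simp add: s_def)
  define k where "k = - (s\<^sup>2 * u / 8)"
  have u3: "w ^ 3 * u ^ 3 = 1" using wu by (metis power_mult_distrib power_one)
  have z1: "1 - z = q\<^sup>2 * u ^ 3 / 64"
  proof -
    have "1 - z = w ^ 3 * u ^ 3 - z" using u3 by simp
    also have "\<dots> = (64 * w ^ 3 + x * s ^ 3) * u ^ 3 / 64"
      unfolding z s_def by (simp add: field_simps)
    also have "64 * w ^ 3 + x * s ^ 3 = q\<^sup>2"
      unfolding w_def s_def q_def by algebra
    finally show ?thesis .
  qed
  have c2: "x * w * (s / 8 * d\<^sup>2) = k * (z * (1 - z))"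
  proof -
    have "x * w * (s / 8 * d\<^sup>2) = (w * u) * (x * s ^ 5 * q\<^sup>2 * u ^ 7 / 32768)"
      unfolding d s_def[symmetric] q_def[symmetric] by (simp add: eval_nat_numeral field_simps) 
    also have "\<dots> = k * (z * (1 - z))"
      unfolding wu z1 k_def unfolding z s_def[symmetric] by (simp add: eval_nat_numeral field_simps)
    finally show ?thesis .
  qed
  have c1: "x * w * ((1/4 + 2 * e * u * (s / 8)) * d + s / 8 * d')
      + (4/3 - (3 * a + 4/3) * x) * (s / 8 * d) = k * (4/3 - 11/6 * z)"
  proof -
    have "x * w * ((1/4 + 2 * e * u * (s / 8)) * d + s / 8 * d')
      + (4/3 - (3 * a + 4/3) * x) * (s / 8 * d) =
      s\<^sup>2 * u ^ 4 / 512 * (x * w * (4 * q + s * (2 * x - 20)) + x * (4 * s * q + 2 * e * s * q) * (w * u)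
         + (4/3 - (3 * a + 4/3) * x) * s * q)"
      unfolding d d' s_def[symmetric] q_def[symmetric] by (simp add: eval_nat_numeral field_simps)
    also have "\<dots> = s\<^sup>2 * u ^ 4 / 512 * (- (256/3) * w ^ 3 - 11/6 * x * s ^ 3)"
      unfolding wu e unfolding w_def s_def q_def by (simp add: eval_nat_numeral field_simps)
    also have "\<dots> = s\<^sup>2 * u / 512 * (- (256/3) * (w ^ 3 * u ^ 3) - 11/6 * x * s ^ 3 * u ^ 3)"
      by (simp add: eval_nat_numeral field_simps)
    also have "\<dots> = k * (4/3 - 11/6 * z)"
      unfolding u3 z k_def s_def[symmetric] by (simp add: eval_nat_numeral field_simps)
    finally show ?thesis .
  qed
  have c0: "x * w * (e * u / 4 + e * (e + 1) * u\<^sup>2 * (s / 8))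
      + (4/3 - (3 * a + 4/3) * x) * (1/8 + e * u * (s / 8)) - 2 * a * (a + 1/3) * (s / 8)
      = - k * ((1/4 + a/2) * (7/12 - a/2))" (is "?l = _")
  proof -
    have "?l = x * (w * u) * (e / 4 + e * (e + 1) * u * (s / 8))
      + (4/3 - (3 * a + 4/3) * x) * (1/8 + e * u * (s / 8)) - 2 * a * (a + 1/3) * (s / 8)"
      by (simp add: eval_nat_numeral field_simps)
    also have "\<dots> = x * (w * u * e / 4 + e * (e + 1) * u * (s / 8))
      + (4/3 - (3 * a + 4/3) * x) * (w * u / 8 + e * u * (s / 8)) - 2 * a * (a + 1/3) * (s / 8) * (w * u)"
      unfolding wu by simp
    also have "\<dots> = u / 8 * (x * (2 * w * e + e * (e + 1) * s)
      + (4/3 - (3 * a + 4/3) * x) * (w + e * s) - 2 * a * (a + 1/3) * s * w)"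
      by (simp add: eval_nat_numeral field_simps)
    also have "\<dots> = u / 8 * (s\<^sup>2 * ((1/4 + a/2) * (7/12 - a/2)))"
      unfolding e w_def s_def by (simp add: eval_nat_numeral field_simps)
    finally show ?thesis unfolding k_def by simp
  qed
  have "x * w * G2 + (4/3 - (2 * a + (a + 1/3) + 1) * x) * G1 - 2 * a * (a + 1/3) * G0 =
      (x * w * (e * u / 4 + e * (e + 1) * u\<^sup>2 * (s / 8))
        + (4/3 - (3 * a + 4/3) * x) * (1/8 + e * u * (s / 8)) - 2 * a * (a + 1/3) * (s / 8)) * H0
    + (x * w * ((1/4 + 2 * e * u * (s / 8)) * d + s / 8 * d')
        + (4/3 - (3 * a + 4/3) * x) * (s / 8 * d)) * H1
    + (x * w * (s / 8 * d\<^sup>2)) * H2"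
    unfolding G0 G1 G2 eight by (simp add: eval_nat_numeral field_simps)
  also have "\<dots> = k * (z * (1 - z) * H2 +
       (4/3 - ((1/4 + a/2) + (7/12 - a/2) + 1) * z) * H1 - (1/4 + a/2) * (7/12 - a/2) * H0)"
    unfolding c0 c1 c2 by (simp add: algebra_simps)
  also have "\<dots> = 0" unfolding ode by simp
  finally show ?thesis unfolding w_def .
qed

text \<open>
  The exponents of the two elementary factors are forced. Over \<open>\<phi> = \<infinity>\<close> the point \<open>1\<close> has multiplicity 3,
  which calls for the exponent \<open>-3 (1/4 + a/2)\<close>. At \<open>-8\<close>, the triple point over \<open>\<phi> = 0\<close>, the exponents \<open>0\<close> and
  \<open>3 (1 - 4/3) = -1\<close> of the pull-back must become \<open>1\<close> and \<open>0\<close>, those of an ordinary point; hence the factor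
  \<open>1 + x / 8\<close>.
\<close>
theorem hypergeo_F_quartic_transformation:
  assumes S: "open S" "connected S" "0 \<in> S" "S \<subseteq> ball 0 1"
    and quartic_S: "\<And>x. x \<in> S \<Longrightarrow> norm (quartic x) < 1"
    and x: "x \<in> S"
  shows "hypergeo_F (2 * a) (a + 1/3) (4/3) x =
    (1 - x) powr - (3/4 + 3 * a / 2) * ((1 + x / 8) * hypergeo_F (1/4 + a/2) (7/12 - a/2) (4/3) (quartic x))"
proof -
  define e where "e = 3/4 + 3 * a / 2"
  define H0 where "H0 = hypergeo_F (1/4 + a/2) (7/12 - a/2) (4/3)"
  have c: "(4/3 :: complex) \<notin> \<int>\<^sub>\<le>\<^sub>0"
    by (rule notin_nonpos_Ints_if_Re_pos) simp
  obtain H1 H2 where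
    H1: "\<And>z. norm z < 1 \<Longrightarrow> (H0 has_field_derivative H1 z) (at z)" and
    H2: "\<And>z. norm z < 1 \<Longrightarrow> (H1 has_field_derivative H2 z) (at z)" and
    ode: "\<And>z. norm z < 1 \<Longrightarrow>
       z * (1 - z) * H2 z + (4/3 - ((1/4 + a/2) + (7/12 - a/2) + 1) * z) * H1 z
         - (1/4 + a/2) * (7/12 - a/2) * H0 z = 0"
    unfolding H0_def using hypergeo_F_ode[OF c, of "1/4 + a/2" "7/12 - a/2"] by metis
  define u where "u = (\<lambda>x::complex. inverse (1 - x))"
  define d where "d = (\<lambda>x. (x + 8)\<^sup>2 * (x\<^sup>2 - 20 * x - 8) * u x ^ 4 / 64)"
  define d' where "d' = (\<lambda>x. (x + 8) * u x ^ 4 * (2 * (x\<^sup>2 - 20 * x - 8) + (x + 8) * (2 * x - 20)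
                    + 4 * (x + 8) * (x\<^sup>2 - 20 * x - 8) * u x) / 64)"
  define L where "L = (\<lambda>x. (1 - x) powr - e)"
  define G0 where "G0 = (\<lambda>x. (1 + x / 8) * H0 (quartic x))"
  define G1 where "G1 = (\<lambda>x. (1/8 + e * u x * (1 + x / 8)) * H0 (quartic x)
                           + (1 + x / 8) * d x * H1 (quartic x))"
  define G2 where "G2 = (\<lambda>x. (e * u x / 4 + e * (e + 1) * (u x)\<^sup>2 * (1 + x / 8)) * H0 (quartic x)
      + ((1/4 + 2 * e * u x * (1 + x / 8)) * d x + (1 + x / 8) * d' x) * H1 (quartic x)
      + (1 + x / 8) * (d x)\<^sup>2 * H2 (quartic x))"
  have in_S: "1 - x \<noteq> 0" "1 - x \<notin> \<real>\<^sub>\<le>\<^sub>0" "norm (quartic x) < 1" if "x \<in> S" for x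
  proof -
    have "norm x < 1" using S that by auto
    hence "Re x < 1" using complex_Re_le_cmod[of x] by linarith
    thus "1 - x \<notin> \<real>\<^sub>\<le>\<^sub>0" "1 - x \<noteq> 0"
      by (auto simp: complex_nonpos_Reals_iff complex_eq_iff)
    show "norm (quartic x) < 1" by (rule quartic_S[OF that])
  qed
  have quartic_u: "quartic x = - x * (x + 8) ^ 3 * u x ^ 3 / 64" for x
    by (simp add: quartic_def u_def field_simps)
  have du: "(u has_field_derivative (u x)\<^sup>2) (at x)" if "x \<in> S" for x
    unfolding u_def using in_S(1)[OF that]
    by (auto intro!: derivative_eq_intros simp: power2_eq_square field_simps)
  have dL: "(L has_field_derivative e * u x * L x) (at x)" if "x \<in> S" for x
    unfolding L_def u_def using in_S[OF that]
    by (auto intro!: derivative_eq_intros simp: powr_diff divide_inverse)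
  have dquartic: "(quartic has_field_derivative d x) (at x)" if "x \<in> S" for x
  proof -
    have u1: "(1 - x) * u x = 1" using in_S(1)[OF that] by (simp add: u_def)
    \<comment> \<open>With products in place of powers the product rule leaves a pure ring identity.\<close>
    have "((\<lambda>x. - (x * ((x + 8) * (x + 8) * (x + 8)) * (u x * u x * u x)) / 64) has_field_derivative
        - ((x + 8)\<^sup>2 * u x ^ 3 * (4 * x + 8 + 3 * x * (x + 8) * u x)) / 64) (at x)"
      by (rule DERIV_cdivide DERIV_minus derivative_eq_intros du that refl)+ algebra
    also have "(\<lambda>x. - (x * ((x + 8) * (x + 8) * (x + 8)) * (u x * u x * u x)) / 64) = quartic"
      by (simp add: fun_eq_iff quartic_u power3_eq_cube)
    also have "- ((x + 8)\<^sup>2 * u x ^ 3 * (4 * x + 8 + 3 * x * (x + 8) * u x)) / 64 =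
        - ((x + 8)\<^sup>2 * u x ^ 3 * ((4 * x + 8) * ((1 - x) * u x) + 3 * x * (x + 8) * u x)) / 64"
      unfolding u1 by simp
    also have "\<dots> = d x"
      unfolding d_def by algebra
    finally show ?thesis .
  qed
  have dd: "(d has_field_derivative d' x) (at x)" if "x \<in> S" for x
  proof -
    have "((\<lambda>x. (x + 8) * (x + 8) * (x * x - 20 * x - 8) * (u x * u x * (u x * u x)) / 64)
            has_field_derivative d' x) (at x)"
      unfolding d'_def
      by (rule DERIV_cdivide derivative_eq_intros du that refl)+ algebra
    also have "(\<lambda>x. (x + 8) * (x + 8) * (x * x - 20 * x - 8) * (u x * u x * (u x * u x)) / 64) = d"
      by (simp add: fun_eq_iff d_def power2_eq_square power4_eq_xxxx mult_ac)
    finally show ?thesis .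
  qed
  have dH0: "((\<lambda>x. H0 (quartic x)) has_field_derivative H1 (quartic x) * d x) (at x)" if "x \<in> S" for x
    by (rule DERIV_chain2[OF H1 dquartic]) (use in_S that in auto)
  have dH1: "((\<lambda>x. H1 (quartic x)) has_field_derivative H2 (quartic x) * d x) (at x)" if "x \<in> S" for x
    by (rule DERIV_chain2[OF H2 dquartic]) (use in_S that in auto)
  have dp: "((\<lambda>x. 1 + x / 8) has_field_derivative 1/8) (at x)" for x :: complex
    by (auto intro!: derivative_eq_intros)
  have dG0: "(G0 has_field_derivative 1/8 * H0 (quartic x) + H1 (quartic x) * d x * (1 + x / 8)) (at x)"
    if "x \<in> S" for x
    unfolding G0_def by (rule DERIV_mult[OF dp dH0[OF that]])
  have dG1: "(G1 has_field_derivative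
      ((0 + (e * (u x)\<^sup>2 * (1 + x / 8) + 1/8 * (e * u x))) * H0 (quartic x)
         + H1 (quartic x) * d x * (1/8 + e * u x * (1 + x / 8))) +
      ((1/8 * d x + d' x * (1 + x / 8)) * H1 (quartic x)
         + H2 (quartic x) * d x * ((1 + x / 8) * d x))) (at x)" if "x \<in> S" for x
    unfolding G1_def
    by (intro DERIV_add DERIV_mult DERIV_const DERIV_cmult dp dH0 dH1 du dd that)
  have "L x * G0 x = hypergeo_F (2 * a) (a + 1/3) (4/3) x"
  proof (rule hypergeo_F_unique[OF c S])
    fix x assume x: "x \<in> S"
    have "G1 x = e * u x * G0 x + (1/8 * H0 (quartic x) + H1 (quartic x) * d x * (1 + x / 8))"
      unfolding G0_def G1_def by (simp add: algebra_simps)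
    thus "((\<lambda>x. L x * G0 x) has_field_derivative L x * G1 x) (at x)"
      using DERIV_mult[OF dL[OF x] dG0[OF x]] by (simp only: algebra_simps)
    have "G2 x = e * u x * G1 x +
      (((0 + (e * (u x)\<^sup>2 * (1 + x / 8) + 1/8 * (e * u x))) * H0 (quartic x)
         + H1 (quartic x) * d x * (1/8 + e * u x * (1 + x / 8))) +
      ((1/8 * d x + d' x * (1 + x / 8)) * H1 (quartic x)
         + H2 (quartic x) * d x * ((1 + x / 8) * d x)))"
      unfolding G1_def G2_def by (simp add: power2_eq_square field_simps)
    thus "((\<lambda>x. L x * G1 x) has_field_derivative L x * G2 x) (at x)"
      using DERIV_mult[OF dL[OF x] dG1[OF x]] by (simp only: algebra_simps)
    have "x * (1 - x) * G2 x + (4/3 - (2 * a + (a + 1/3) + 1) * x) * G1 x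
            - 2 * a * (a + 1/3) * G0 x = 0"
    proof (rule quartic_ode_transfer)
      show "(1 - x) * u x = 1" using in_S(1)[OF x] by (simp add: u_def)
    qed (rule ode[OF in_S(3)[OF x]] quartic_u d_def[THEN fun_cong] d'_def[THEN fun_cong] e_def
           G0_def[THEN fun_cong] G1_def[THEN fun_cong] G2_def[THEN fun_cong])+
    hence "L x * (x * (1 - x) * G2 x + (4/3 - (2 * a + (a + 1/3) + 1) * x) * G1 x
            - 2 * a * (a + 1/3) * G0 x) = 0"
      by simp
    thus "x * (1 - x) * (L x * G2 x) + (4/3 - (2 * a + (a + 1/3) + 1) * x) * (L x * G1 x)
            - 2 * a * (a + 1/3) * (L x * G0 x) = 0"
      by (simp only: algebra_simps)
  next
    show "L 0 * G0 0 = 1"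
      by (simp add: L_def G0_def H0_def quartic_def)
  qed (rule x)
  thus ?thesis
    by (simp add: L_def G0_def H0_def e_def)
qed

section \<open>The special value\<close>

text \<open>
  The factorisation of \<open>1 - \<phi>\<close> shows \<open>0 \<le> \<phi> \<le> 1\<close> on the segment; the value 1 occurs only at a
  root of \<open>x\<^sup>2 - 20 x - 8\<close>, that is, at its left end point.
\<close>
lemma quartic_of_real:
  fixes t :: real
  assumes "10 - 6 * sqrt 3 \<le> t" "t \<le> 0"
  shows "norm (quartic (of_real t)) \<le> 1"
    and "10 - 6 * sqrt 3 < t \<Longrightarrow> norm (quartic (of_real t)) < 1"
proof -
  define r where "r = - t * (t + 8) ^ 3 / (64 * (1 - t) ^ 3)"
  have r: "quartic (of_real t) = of_real r"
    by (simp add: r_def quartic_def)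
  have sqrt3: "6 * sqrt 3 < 11"
    by (rule power2_less_imp_less) (auto simp: power_mult_distrib)
  have t8: "t + 8 > 0" using assms sqrt3 by linarith
  have "r \<ge> 0"
    unfolding r_def using assms t8 by (intro divide_nonneg_nonneg mult_nonneg_nonneg) auto
  have "complex_of_real (1 - r) = of_real ((t\<^sup>2 - 20 * t - 8)\<^sup>2 / (64 * (1 - t) ^ 3))"
    using one_minus_quartic[of "of_real t"] assms unfolding of_real_diff r[symmetric] by simp
  hence r1: "1 - r = (t\<^sup>2 - 20 * t - 8)\<^sup>2 / (64 * (1 - t) ^ 3)"
    by (simp only: of_real_eq_iff)
  have "1 - r \<ge> 0"
    unfolding r1 using assms by simp
  with \<open>r \<ge> 0\<close> show "norm (quartic (of_real t)) \<le> 1"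
    by (simp add: r)
  assume "10 - 6 * sqrt 3 < t"
  hence "(10 - t)\<^sup>2 < (6 * sqrt 3)\<^sup>2"
    using assms by (intro power_strict_mono) auto
  hence "t\<^sup>2 - 20 * t - 8 < 0"
    by (simp add: power2_diff power_mult_distrib)
  hence "(t\<^sup>2 - 20 * t - 8)\<^sup>2 > 0"
    by simp
  hence "1 - r > 0"
    unfolding r1 using assms by (intro divide_pos_pos) auto
  with \<open>r \<ge> 0\<close> show "norm (quartic (of_real t)) < 1"
    by (simp add: r)
qed

text \<open>
  The part of the unit disc that \<open>\<phi>\<close> maps into the unit disc may be disconnected, so the
  transformation is applied to the component of \<open>0\<close>, which contains the segment.
\<close>
lemma hypergeo_F_quartic_transformation_interval:
  fixes t :: real
  assumes t: "10 - 6 * sqrt 3 < t" "t \<le> 0"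
  shows "hypergeo_F (2 * a) (a + 1/3) (4/3) (of_real t) =
    (1 - of_real t) powr - (3/4 + 3 * a / 2) *
      ((1 + of_real t / 8) * hypergeo_F (1/4 + a/2) (7/12 - a/2) (4/3) (quartic (of_real t)))"
proof -
  define D where "D = {x \<in> ball 0 1. quartic x \<in> ball 0 1}"
  define S where "S = connected_component_set D 0"
  have "continuous_on (ball 0 1) quartic"
    unfolding quartic_def[abs_def] by (auto intro!: continuous_intros)
  hence "open (ball 0 1 \<inter> quartic -` ball 0 1)"
    by (intro continuous_open_preimage) auto
  also have "ball 0 1 \<inter> quartic -` ball 0 1 = D"
    by (auto simp: D_def)
  finally have "open D" .
  have sqrt3: "6 * sqrt 3 < 11"
    by (rule power2_less_imp_less) (auto simp: power_mult_distrib)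
  have path: "complex_of_real ` {t..0} \<subseteq> D"
    using t sqrt3 quartic_of_real(2) by (auto simp: D_def)
  have "connected (complex_of_real ` {t..0})"
    by (intro connected_continuous_image continuous_intros) auto
  moreover have ends: "0 \<in> complex_of_real ` {t..0}" "of_real t \<in> complex_of_real ` {t..0}"
    using t by (auto simp: image_iff)
  ultimately have "complex_of_real ` {t..0} \<subseteq> S"
    unfolding S_def using path by (intro connected_component_maximal)
  hence "of_real t \<in> S" "0 \<in> S"
    using ends by blast+
  moreover have "open S" "connected S" "S \<subseteq> D"
    using \<open>open D\<close> unfolding S_def
    by (auto simp: open_connected_component connected_component_subset)
  ultimately show ?thesis
    by (intro hypergeo_F_quartic_transformation[of S]) (auto simp: D_def)
qed

theorem mainTheorem18:
  fixes a :: complex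
  shows "hypergeo_F (2 * a) (a + 1/3) (4/3) (complex_of_real (10 - 6 * sqrt 3)) =
    3 powr (- (9 * a / 4) - 5/8) * complex_of_real (sqrt 3 - 1) powr (- (3 * a) - 1/2)
      * complex_of_real (sqrt pi) * Gamma (1/3) / 2 powr (5/4 - 3 * a / 2)
      * rGamma (13/12 - a / 2) * rGamma (a / 2 + 3/4)"
proof -
  define x0 where "x0 = 10 - 6 * sqrt 3"
  define G where "G = (\<lambda>t::real. (1 - complex_of_real t) powr - (3/4 + 3 * a / 2) *
      ((1 + of_real t / 8) * hypergeo_F (1/4 + a/2) (7/12 - a/2) (4/3) (quartic (of_real t))))"
  have c: "(4/3 :: complex) \<notin> \<int>\<^sub>\<le>\<^sub>0"
    by (rule notin_nonpos_Ints_if_Re_pos) simp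
  have sqrt3_less: "6 * sqrt 3 < 11"
    by (rule power2_less_imp_less) (auto simp: power_mult_distrib)
  have sqrt3_greater: "5 < 3 * sqrt 3"
    by (rule power2_less_imp_less) (auto simp: power_mult_distrib)
  have x0: "-1 < x0" "x0 < 0"
    using sqrt3_less sqrt3_greater by (auto simp: x0_def)
  have cont_quartic: "continuous_on {x0..0} (\<lambda>t. quartic (of_real t))"
    unfolding quartic_def using x0
    by (intro continuous_intros) (auto simp: complex_eq_iff)
  have cont_G: "continuous_on {x0..0} G"
    unfolding G_def
  proof (intro continuous_on_mult)
    show "continuous_on {x0..0} (\<lambda>t. hypergeo_F (1/4 + a/2) (7/12 - a/2) (4/3) (quartic (of_real t)))"
      using quartic_of_real(1)
      by (intro continuous_on_compose2[OF hypergeo_F_continuous_cball[OF c] cont_quartic])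
         (auto simp: x0_def)
  qed (auto intro!: continuous_intros simp: complex_nonpos_Reals_iff)
  have cont_F: "continuous_on {x0..0} (\<lambda>t. hypergeo_F (2 * a) (a + 1/3) (4/3) (of_real t))"
    by (rule continuous_on_compose2[OF holomorphic_on_imp_continuous_on[OF hypergeo_F_holomorphic[OF c]]])
       (use x0 in \<open>auto intro!: continuous_intros\<close>)
  have "hypergeo_F (2 * a) (a + 1/3) (4/3) (of_real x0) - G x0 = 0"
  proof (rule continuous_constant_on_closure[of "{x0<..0}"
      "\<lambda>t. hypergeo_F (2 * a) (a + 1/3) (4/3) (of_real t) - G t"])
    show "continuous_on (closure {x0<..0}) (\<lambda>t. hypergeo_F (2 * a) (a + 1/3) (4/3) (of_real t) - G t)"
      using x0 cont_F cont_G by (auto intro!: continuous_on_diff)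
    show "hypergeo_F (2 * a) (a + 1/3) (4/3) (of_real t) - G t = 0" if "t \<in> {x0<..0}" for t
      using that hypergeo_F_quartic_transformation_interval[of t a] by (auto simp: x0_def G_def)
  qed (use x0 in auto)
  hence F_eq_G: "hypergeo_F (2 * a) (a + 1/3) (4/3) (of_real x0) = G x0"
    by simp

  have "1 - quartic (of_real x0) = 0"
  proof -
    have "x0\<^sup>2 - 20 * x0 - 8 = 0"
      unfolding x0_def by (simp add: power2_eq_square algebra_simps)
    from arg_cong[OF this, of complex_of_real]
    have "(of_real x0)\<^sup>2 - 20 * of_real x0 - 8 = (0 :: complex)"
      by simp
    thus ?thesis
      using x0 by (subst one_minus_quartic) auto
  qed
  hence "quartic (of_real x0) = 1" by simp
  moreover have "hypergeo_F (1/4 + a/2) (7/12 - a/2) (4/3) 1 =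
      Gamma (4/3) * complex_of_real (sqrt pi) * rGamma (13/12 - a / 2) * rGamma (a / 2 + 3/4)"
  proof -
    have diffs: "4/3 - (1/4 + a/2) - (7/12 - a/2) = 1/2" "4/3 - (1/4 + a/2) = 13/12 - a / 2"
      "4/3 - (7/12 - a/2) = a / 2 + 3/4"
      by (auto simp: field_simps)
    have "Re (4/3 - (1/4 + a/2) - (7/12 - a/2)) > 0"
      unfolding diffs(1) by simp
    from Gauss_hypergeo_F_1[OF c this] show ?thesis
      unfolding diffs(1) unfolding diffs(2,3) Gamma_one_half_complex .
  qed
  moreover have "Gamma (4/3 :: complex) = Gamma (1/3) / 3"
    using Gamma_plus1[of "1/3 :: complex"] notin_nonpos_Ints_if_Re_pos[of "1/3"] by simp
  ultimately have G: "G x0 = (1 - of_real x0) powr - (3/4 + 3 * a / 2) * (1 + of_real x0 / 8) / 3 *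
      (of_real (sqrt pi) * Gamma (1/3) * rGamma (13/12 - a / 2) * rGamma (a / 2 + 3/4))"
    by (simp add: G_def mult_ac)

  define s where "s = sqrt 3 - 1"
  \<comment> \<open>Every remaining factor is an exponential of a linear combination of these three logarithms, so
    that complex powers of positive reals reduce to comparing exponents.\<close>
  define l2 l3 ls where "l2 = ln (2::real)" and "l3 = ln (3::real)" and "ls = ln s"
  have s: "s > 0" by (simp add: s_def)
  have exps: "exp l2 = 2" "exp l3 = 3" "exp ls = s"
    using s by (simp_all add: l2_def l3_def ls_def)
  have sqrt3: "exp (l3 / 2) = sqrt 3"
    by (simp add: l3_def ln_sqrt[symmetric])
  have exp32: "exp (3 / 2 * l3) = 3 * sqrt 3"
  proof -
    have "exp (3 / 2 * l3) = exp (l3 + l3 / 2)" by simp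
    thus ?thesis unfolding exp_add sqrt3 exps .
  qed
  have one_minus: "1 - x0 = exp (3 / 2 * l3 + 2 * ls - l2)"
    unfolding exp_add exp_diff exp32 exps(1) exp_double exps(3)
    by (simp add: x0_def s_def power2_eq_square algebra_simps)
  have one_plus: "1 + x0 / 8 = exp (3 / 2 * l3 + ls - 2 * l2)"
    unfolding exp_add exp_diff exp32 exp_double exps
    by (simp add: x0_def s_def field_simps)
  have powr_exp: "of_real r powr z = exp (z * of_real (ln r))" if "r > 0" for r :: real and z :: complex
    using that by (simp add: powr_def Ln_of_real)
  have "ln (1 - x0) = 3 / 2 * l3 + 2 * ls - l2"
    unfolding one_minus by (rule ln_exp)
  hence "(1 - complex_of_real x0) powr - (3/4 + 3 * a / 2) =
      exp (- (3/4 + 3 * a / 2) * of_real (3 / 2 * l3 + 2 * ls - l2))"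
    using powr_exp[of "1 - x0" "- (3/4 + 3 * a / 2)"] x0 by (simp only: of_real_diff of_real_1)
  moreover have "1 + complex_of_real x0 / 8 = exp (of_real (3 / 2 * l3 + ls - 2 * l2))"
    using arg_cong[OF one_plus, of complex_of_real] by (simp only: exp_of_real) simp
  moreover have "(3 :: complex) = exp (of_real l3)"
    using arg_cong[OF exps(2), of complex_of_real] by (simp only: exp_of_real) simp
  ultimately have "(1 - of_real x0) powr - (3/4 + 3 * a / 2) * (1 + of_real x0 / 8) / 3 =
      exp (- (3/4 + 3 * a / 2) * of_real (3 / 2 * l3 + 2 * ls - l2)
             + of_real (3 / 2 * l3 + ls - 2 * l2) - of_real l3)"
    by (simp only: exp_add exp_diff)
  also have "\<dots> = exp ((- (9 * a / 4) - 5/8) * of_real l3 + (- (3 * a) - 1/2) * of_real ls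
                       - (5/4 - 3 * a / 2) * of_real l2)"
    by (rule arg_cong[of _ _ exp]) (simp add: field_simps)
  also have "\<dots> = 3 powr (- (9 * a / 4) - 5/8) * complex_of_real s powr (- (3 * a) - 1/2)
                      / 2 powr (5/4 - 3 * a / 2)"
    using powr_exp[of 3] powr_exp[of 2] powr_exp[of s] s
    by (simp add: exp_add exp_diff l2_def l3_def ls_def)
  finally show ?thesis
    unfolding F_eq_G[unfolded x0_def] G[unfolded x0_def] by (simp add: s_def x0_def mult_ac)
qed

end
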